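(* Let $n,k,d,\beta$ be positive integers with $k\le d<n$, let $\mathbb{F}_q$ be any finite field with $q\ge n$, and put $\alpha=d\beta$ and $B=\left(kd-\binom{k}{2}\right)\beta$. Then there exists a systematic linear code over $\mathbb{F}_q$ storing a file of $B$ symbols over $\mathbb{F}_q$ across $n$ nodes, each storing $\alpha$ symbols over $\mathbb{F}_q$, such that: (i) the entire file can be recovered from the data stored in any $k$ of the $n$ nodes; (ii) the data stored in any node can be recovered from any $d$ other nodes with a download of exactly $\beta=\frac{B}{kd-\binom{k}{2}}$ symbols from each of the $d$ nodes; (iii) the data stored in any systematic node can be recovered from any $d$ other nodes with both the download from each of these $d$ nodes and the read at each of these $d$ nodes equal to $\beta=\frac{B}{kd-\binom{k}{2}}$ symbols (i.e., by repair-by-transfer).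
   Context: A linear code here is given by $\mathbb{F}_q$-linear encoding maps $f_i:\mathbb{F}_q^B\to\mathbb{F}_q^\alpha$, $i=1,\dots,n$; for file $F\in\mathbb{F}_q^B$, node $i$ stores $W_i=f_i(F)$. The code is systematic if some $k$ of the $n$ nodes store data in raw (uncoded) form, i.e. every symbol stored in them is one of the $B$ file symbols; these $k$ nodes are the systematic nodes and the other $n-k$ nodes are parity nodes. To recover the data of node $i$ from a set $\mathcal{D}$ of $d$ other nodes, each $j\in\mathcal{D}$ passes some symbols over $\mathbb{F}_q$ computed as a function of $W_j$ (the function may depend on $i,j,\mathcal{D}$ but not on the file), and $W_i$ must be determined by everything passed. The download from node $j$ is the number of symbols it passes. The read at node $j$ is the number of its $\alpha$ stored symbols that must be accessed in order to compute what it passes. Repair-by-transfer means that each helper node simply reads and passes some of its stored symbols without any computation. *)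

theory Defs
  imports "Jordan_Normal_Form.VS_Connect"
begin

text \<open>
  Nodes are the numbers below \<open>n\<close>.  A code is a family \<open>f\<close> of encoding maps: node \<open>i\<close> stores
  \<open>f i F\<close> for the file \<open>F\<close>.  Symbols are elements of the type \<open>'a\<close>.
\<close>

definition linear_code :: "nat \<Rightarrow> nat \<Rightarrow> nat \<Rightarrow> (nat \<Rightarrow> 'a::field vec \<Rightarrow> 'a vec) \<Rightarrow> bool" where
  "linear_code n B \<alpha> f \<longleftrightarrow>
     (\<forall>i<n. linear_map class_ring (module_vec TYPE('a) B) (module_vec TYPE('a) \<alpha>) (f i))"

definition systematic_nodes ::
  "nat \<Rightarrow> nat \<Rightarrow> nat \<Rightarrow> nat \<Rightarrow> (nat \<Rightarrow> 'a vec \<Rightarrow> 'a vec) \<Rightarrow> nat set \<Rightarrow> bool" where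
  "systematic_nodes n k B \<alpha> f S \<longleftrightarrow>
     S \<subseteq> {..<n} \<and> card S = k \<and>
     (\<forall>i\<in>S. \<forall>s<\<alpha>. \<exists>b<B. \<forall>F\<in>carrier_vec B. f i F $ s = F $ b)"

text \<open>The data \<open>Y F\<close> can be recovered from the data \<open>X F\<close>, without other knowledge of the
  file \<open>F\<close>.\<close>

definition recoverable_from :: "nat \<Rightarrow> ('a vec \<Rightarrow> 'b) \<Rightarrow> ('a vec \<Rightarrow> 'c) \<Rightarrow> bool" where
  "recoverable_from B X Y \<longleftrightarrow> (\<exists>g. \<forall>F\<in>carrier_vec B. g (X F) = Y F)"

text \<open>The restriction to \<open>K\<close> and \<open>D\<close> below ensures that the decoder sees only the data of these
  nodes.\<close>

definition file_recoverable ::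
  "nat \<Rightarrow> (nat \<Rightarrow> 'a vec \<Rightarrow> 'a vec) \<Rightarrow> nat set \<Rightarrow> bool" where
  "file_recoverable B f K \<longleftrightarrow> recoverable_from B (\<lambda>F. \<lambda>j\<in>K. f j F) (\<lambda>F. F)"

text \<open>Node \<open>j \<in> D\<close> passes the symbols \<open>\<phi> j (f j F)\<close>; the maps \<open>\<phi> j\<close> need not be linear.\<close>

definition repairs ::
  "nat \<Rightarrow> (nat \<Rightarrow> 'a vec \<Rightarrow> 'a vec) \<Rightarrow> nat \<Rightarrow> nat set \<Rightarrow> (nat \<Rightarrow> 'a vec \<Rightarrow> 'a vec) \<Rightarrow> bool" where
  "repairs B f i D \<phi> \<longleftrightarrow> recoverable_from B (\<lambda>F. \<lambda>j\<in>D. \<phi> j (f j F)) (f i)"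

definition has_download :: "nat \<Rightarrow> ('a vec \<Rightarrow> 'a vec) \<Rightarrow> nat \<Rightarrow> bool" where
  "has_download \<alpha> \<phi> m \<longleftrightarrow> \<phi> \<in> carrier_vec \<alpha> \<rightarrow> carrier_vec m"

definition computable_from :: "nat \<Rightarrow> ('a vec \<Rightarrow> 'a vec) \<Rightarrow> nat set \<Rightarrow> bool" where
  "computable_from \<alpha> \<phi> R \<longleftrightarrow>
     (\<forall>w\<in>carrier_vec \<alpha>. \<forall>w'\<in>carrier_vec \<alpha>. (\<forall>s\<in>R. w $ s = w' $ s) \<longrightarrow> \<phi> w = \<phi> w')"

definition read_count :: "nat \<Rightarrow> ('a vec \<Rightarrow> 'a vec) \<Rightarrow> nat" where
  "read_count \<alpha> \<phi> = (LEAST r. \<exists>R\<subseteq>{..<\<alpha>}. card R = r \<and> computable_from \<alpha> \<phi> R)"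

definition by_transfer :: "nat \<Rightarrow> ('a vec \<Rightarrow> 'a vec) \<Rightarrow> nat \<Rightarrow> bool" where
  "by_transfer \<alpha> \<phi> m \<longleftrightarrow>
     (\<exists>p. p \<in> {..<m} \<rightarrow> {..<\<alpha>} \<and> inj_on p {..<m} \<and>
          (\<forall>w\<in>carrier_vec \<alpha>. \<phi> w = vec m (\<lambda>t. w $ p t)))"

end

(* Product-matrix construction.  For beta = 1 the file fills a symmetric d x d matrix M whose lower
   right (d-k) x (d-k) block is zero, and node i stores psi_i^T M.  The entries of psi_i are the
   values at the i-th of n distinct field elements x_0, ..., x_(n-1) of a basis of the polynomials of
   degree < d: the Lagrange basis for x_0, ..., x_(k-1), followed by the multiples z^l Z of
   Z = (z - x_0) ... (z - x_(k-1)).  A polynomial has at most as many roots as its degree, so any d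
   of the psi_i are independent, and so are any k of them cut off after k entries; the latter
   lets any k nodes recover M.  Helper j passes psi_j^T M psi_i, so d helpers determine M psi_i,
   which by symmetry is the data of node i.  For i < k the row psi_i is the i-th unit vector: node i
   stores a row of M in raw form, and helper j passes its i-th symbol.  For general beta, use
   beta independent copies. *)

theory Submission
  imports Defs
begin

section \<open>Encoding rows from polynomial evaluation\<close>

text \<open>The combination has degree below \<open>m\<close> but vanishes at the \<open>m\<close>
  distinct points \<open>x j\<close>, \<open>j \<in> J\<close>; a nonzero polynomial cannot have
  that many roots.\<close>

lemma poly_combination_eq_0_if_many_roots:
  fixes p :: "nat \<Rightarrow> 'a::field poly" and x :: "nat \<Rightarrow> 'a"
  assumes x: "inj_on x {..<n}" and J: "J \<subseteq> {..<n}" "card J = m"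
    and deg: "\<And>a. a < m \<Longrightarrow> degree (p a) < m"
    and zero: "\<forall>j\<in>J. (\<Sum>a<m. poly (p a) (x j) * c a) = 0"
  shows "(\<Sum>a<m. Polynomial.smult (c a) (p a)) = 0"
proof (rule ccontr)
  let ?P = "\<Sum>a<m. Polynomial.smult (c a) (p a)"
  assume P: "?P \<noteq> 0"
  then have "0 < m"
    by (cases m) auto
  then have "degree ?P < m"
    using deg by (intro degree_sum_less) (auto intro: le_less_trans[OF degree_smult_le])
  moreover have "x ` J \<subseteq> {z. poly ?P z = 0}"
    using zero by (auto simp: poly_sum mult.commute)
  then have "card (x ` J) \<le> degree ?P"
    by (rule order.trans[OF card_mono[OF poly_roots_finite[OF P]] card_poly_roots_bound[OF P]])
  ultimately show False
    using card_image[OF inj_on_subset[OF x J(1)]] J(2) by simp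
qed

text \<open>The first \<open>m \<ge> k\<close> basis polynomials all have degree below
  \<open>m\<close>, so a single family of rows is independent after truncation at \<open>k\<close>
  (file recovery) and at \<open>d\<close> (repair).\<close>

lemma exists_systematic_MDS_rows:
  fixes x :: "nat \<Rightarrow> 'a::field"
  assumes x: "inj_on x {..<n}" and "k \<le> n"
  obtains \<psi> :: "nat \<Rightarrow> nat \<Rightarrow> 'a"
  where "\<And>i a. i < k \<Longrightarrow> \<psi> i a = (if a = i then 1 else 0)"
    and "\<And>m J c a. k \<le> m \<Longrightarrow> J \<subseteq> {..<n} \<Longrightarrow> card J = m \<Longrightarrow>
           \<forall>j\<in>J. (\<Sum>a<m. \<psi> j a * c a) = 0 \<Longrightarrow> a < m \<Longrightarrow> c a = 0"
proof -
  define L where "L a = (\<Prod>i\<in>{..<k} - {a}. Polynomial.smult (inverse (x a - x i)) [:- x i, 1:])" for a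
  define Z where "Z = (\<Prod>i<k. [:- x i, 1:])"
  define p where "p a = (if a < k then L a else Z * Polynomial.monom 1 (a - k))" for a
  have xne: "x a \<noteq> x i" if "a < k" "i < k" "i \<noteq> a" for a i
    using inj_onD[OF x, of a i] that \<open>k \<le> n\<close> by auto
  have delta: "poly (p a) (x i) = (if a = i then 1 else 0)" if i: "i < k" for i a
  proof (cases "a < k")
    case True
    have "inverse (x i - x j) * (x i - x j) = 1" if "j < k" "j \<noteq> i" for j
      using xne[OF i that] by simp
    with True show ?thesis
      using i by (auto simp: p_def L_def poly_prod algebra_simps intro!: prod.neutral)
  next
    case False
    then show ?thesis
      using i by (auto simp: p_def Z_def poly_prod)
  qed
  have degL: "degree (L a) < k" if "a < k" for a
  proof -
    have "degree (L a) \<le> (\<Sum>i\<in>{..<k} - {a}. 1)"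
      unfolding L_def
      by (rule order.trans[OF degree_prod_sum_le])
        (auto intro!: sum_mono order.trans[OF degree_smult_le] simp del: sum_constant split: if_split_asm)
    then show ?thesis
      using that by simp
  qed
  have Z0: "Z \<noteq> 0" and degZ: "degree Z = k"
    unfolding Z_def by (simp_all add: degree_prod_sum_eq)
  have degp: "degree (p a) < m" if "a < m" "k \<le> m" for a m
    using degL[of a] that Z0
    by (auto simp: p_def degree_mult_eq monom_eq_0_iff degZ degree_monom_eq)
  show thesis
  proof
    show "poly (p a) (x i) = (if a = i then 1 else 0)" if "i < k" for i a
      using delta that .
  next
    fix m J c a
    assume m: "k \<le> m" and J: "J \<subseteq> {..<n}" "card J = m" and a: "a < m"
      and zero: "\<forall>j\<in>J. (\<Sum>a<m. poly (p a) (x j) * c a) = 0"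
    have P: "(\<Sum>a<m. Polynomial.smult (c a) (p a)) = 0"
      using poly_combination_eq_0_if_many_roots[OF x J degp zero] m by blast
    \<comment> \<open>Evaluation at \<open>x i\<close> kills every basis polynomial except the
      \<open>i\<close>-th.\<close>
    have low: "c i = 0" if "i < k" for i
    proof -
      have "0 = poly (\<Sum>a<m. Polynomial.smult (c a) (p a)) (x i)"
        using P by simp
      also have "\<dots> = (\<Sum>a<m. if a = i then c a else 0)"
        unfolding poly_sum using delta[OF that] by (intro sum.cong) auto
      also have "\<dots> = c i"
        using that m by simp
      finally show ?thesis
        by simp
    qed
    show "c a = 0"
    proof (cases "a < k")
      case False
      \<comment> \<open>With the Lagrange part gone, \<open>Z\<close> factors out and cancels; the
        cofactor has the remaining \<open>c a\<close> as its coefficients.\<close>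
      have "(\<Sum>a<m. Polynomial.smult (c a) (p a)) = (\<Sum>a\<in>{k..<m}. Polynomial.smult (c a) (p a))"
        using low by (intro sum.mono_neutral_right) auto
      also have "\<dots> = Z * (\<Sum>a\<in>{k..<m}. Polynomial.monom (c a) (a - k))"
        unfolding sum_distrib_left by (intro sum.cong) (simp_all add: p_def flip: mult_smult_right, simp add: smult_monom)
      finally have "0 = Polynomial.coeff (\<Sum>a\<in>{k..<m}. Polynomial.monom (c a) (a - k)) (a - k)"
        using P Z0 by simp
      also have "\<dots> = (\<Sum>b\<in>{k..<m}. if b = a then c b else 0)"
        unfolding coeff_sum using False by (intro sum.cong) auto
      also have "\<dots> = c a"
        using False a by simp
      finally show ?thesis
        by simp
    qed (rule low)
  qed
qed

section \<open>File size, decoders and read cost\<close>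

text \<open>Counts the free entries of one message matrix, row \<open>a\<close> contributing
  \<open>d - a\<close>. The binomial stands on the left to avoid truncated subtraction.\<close>

lemma card_upper_triangle:
  assumes "k \<le> d"
  shows "card {(a, b). a < k \<and> a \<le> b \<and> b < d} + (k choose 2) = k * (d::nat)"
proof -
  have "{(a, b). a < k \<and> a \<le> b \<and> b < d} = Sigma {..<k} (\<lambda>a. {a..<d})"
    by auto
  then have "card {(a, b). a < k \<and> a \<le> b \<and> b < d} = (\<Sum>a<k. d - a)"
    by simp
  also have "(\<Sum>a<k. d - a) + (k choose 2) = k * d"
    using assms by (induction k) (auto simp: numeral_2_eq_2)
  finally show ?thesis .
qed

text \<open>The decoder may pick any file consistent with the data it sees, so it suffices that
  \<open>Y\<close> is constant on the fibres of \<open>X\<close>.\<close>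

lemma recoverable_fromI:
  fixes X :: "'a vec \<Rightarrow> 'b"
  assumes "\<And>F F'. F \<in> carrier_vec B \<Longrightarrow> F' \<in> carrier_vec B \<Longrightarrow> X F = X F' \<Longrightarrow> Y F = Y F'"
  shows "recoverable_from B X Y"
  unfolding recoverable_from_def
proof (intro exI ballI)
  fix F :: "'a vec"
  assume F: "F \<in> carrier_vec B"
  let ?G = "inv_into (carrier_vec B) X (X F)"
  have "?G \<in> carrier_vec B" and "X ?G = X F"
    using F by (auto intro: inv_into_into f_inv_into_f)
  then show "(\<lambda>z. Y (inv_into (carrier_vec B) X z)) (X F) = Y F"
    using assms[OF _ F] by simp
qed

text \<open>Reading the \<open>m\<close> passed positions suffices. Conversely, if
  \<open>p t\<close> were not read, the zero vector and the unit vector at \<open>p t\<close> would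
  look alike but differ in passed symbol \<open>t\<close>.\<close>

lemma read_count_transfer:
  fixes \<phi> :: "'a::zero_neq_one vec \<Rightarrow> 'a vec"
  assumes "by_transfer \<alpha> \<phi> m"
  shows "read_count \<alpha> \<phi> = m"
proof -
  obtain p where p: "p \<in> {..<m} \<rightarrow> {..<\<alpha>}" "inj_on p {..<m}"
    and \<phi>: "\<And>w. w \<in> carrier_vec \<alpha> \<Longrightarrow> \<phi> w = vec m (\<lambda>t. w $ p t)"
    using assms unfolding by_transfer_def by blast
  have "p ` {..<m} \<subseteq> {..<\<alpha>} \<and> card (p ` {..<m}) = m \<and> computable_from \<alpha> \<phi> (p ` {..<m})"
    using p by (auto simp: card_image computable_from_def \<phi>)
  moreover have "m \<le> card R" if R: "R \<subseteq> {..<\<alpha>}" "computable_from \<alpha> \<phi> R" for R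
  proof -
    have "p t \<in> R" if t: "t < m" for t
    proof (rule ccontr)
      assume "p t \<notin> R"
      then have "\<forall>s\<in>R. (0\<^sub>v \<alpha> :: 'a vec) $ s = unit_vec \<alpha> (p t) $ s"
        using R(1) by (auto simp: unit_vec_def)
      then have "\<phi> (0\<^sub>v \<alpha>) = \<phi> (unit_vec \<alpha> (p t))"
        using R(2) unfolding computable_from_def by (meson unit_vec_carrier zero_carrier_vec)
      then have "vec m (\<lambda>t. (0\<^sub>v \<alpha> :: 'a vec) $ p t) $ t = vec m (\<lambda>s. unit_vec \<alpha> (p t) $ p s) $ t"
        by (simp add: \<phi>)
      moreover have "p t < \<alpha>"
        using p(1) t by auto
      ultimately show False
        using t by simp
    qed
    then have "p ` {..<m} \<subseteq> R"
      by auto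
    then have "card (p ` {..<m}) \<le> card R"
      using finite_subset[OF R(1)] by (intro card_mono) auto
    then show ?thesis
      using p(2) by (simp add: card_image)
  qed
  ultimately show ?thesis
    unfolding read_count_def by (intro Least_equality) blast+
qed

section \<open>The product-matrix code\<close>

text \<open>\<open>h\<close> assigns to each free entry \<open>(a, b)\<close> of the
  \<open>t\<close>-th message matrix the file symbol placed there.\<close>

locale product_matrix_code =
  fixes n k d \<beta> B :: nat and \<psi> :: "nat \<Rightarrow> nat \<Rightarrow> 'a::field" and h :: "nat \<times> nat \<times> nat \<Rightarrow> nat"
  assumes k_le_d: "k \<le> d"
    and h: "bij_betw h {(a, b, t). a < k \<and> a \<le> b \<and> b < d \<and> t < \<beta>} {..<B}"
    and systematic: "\<And>i a. i < k \<Longrightarrow> \<psi> i a = (if a = i then 1 else 0)"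
    and rows_independent: "\<And>m J c a. m = k \<or> m = d \<Longrightarrow> J \<subseteq> {..<n} \<Longrightarrow> card J = m \<Longrightarrow>
           \<forall>j\<in>J. (\<Sum>a<m. \<psi> j a * c a) = 0 \<Longrightarrow> a < m \<Longrightarrow> c a = 0"
begin

text \<open>The \<open>t\<close>-th message matrix: symmetric, with zero lower right \<open>(d-k) \<times> (d-k)\<close> block.\<close>

definition message :: "'a vec \<Rightarrow> nat \<Rightarrow> nat \<Rightarrow> nat \<Rightarrow> 'a" where
  "message F t a b = (if min a b < k then F $ h (min a b, max a b, t) else 0)"

text \<open>Symbol \<open>b * \<beta> + t\<close> of a node is entry \<open>b\<close> of its row in the \<open>t\<close>-th of \<open>\<beta>\<close> independent
  copies of the code for \<open>\<beta> = 1\<close>.\<close>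

definition encode :: "nat \<Rightarrow> 'a vec \<Rightarrow> 'a vec" where
  "encode i F = vec (d * \<beta>) (\<lambda>s. \<Sum>a<d. \<psi> i a * message F (s mod \<beta>) a (s div \<beta>))"

text \<open>Here \<open>i\<close> is the failed node; every helper applies this same map to its own
  data \<open>w\<close>.\<close>

definition helper :: "nat \<Rightarrow> 'a vec \<Rightarrow> 'a vec" where
  "helper i w = vec \<beta> (\<lambda>t. \<Sum>b<d. w $ (b * \<beta> + t) * \<psi> i b)"

lemma message_sym: "message F t a b = message F t b a"
  by (simp add: message_def min.commute max.commute)

lemma h_less:
  assumes "a < d" "b < d" "min a b < k" "t < \<beta>"
  shows "h (min a b, max a b, t) < B"
proof -
  have "(min a b, max a b, t) \<in> {(a, b, t). a < k \<and> a \<le> b \<and> b < d \<and> t < \<beta>}"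
    using assms by auto
  then show ?thesis
    using bij_betwE[OF h] by blast
qed

lemma index_bounds:
  assumes "s < d * \<beta>"
  shows "s div \<beta> < d" "s mod \<beta> < \<beta>"
proof -
  show "s mod \<beta> < \<beta>"
    using assms by (cases "\<beta> = 0") auto
  show "s div \<beta> < d"
    using assms by (simp add: less_mult_imp_div_less)
qed

lemma index_less:
  assumes "b < d" "t < \<beta>"
  shows "b * \<beta> + t < d * \<beta>"
proof -
  have "b * \<beta> + t < Suc b * \<beta>"
    using assms by simp
  also have "\<dots> \<le> d * \<beta>"
    using assms by (intro mult_le_mono1) simp
  finally show ?thesis .
qed

lemma encode_index:
  assumes "b < d" "t < \<beta>"
  shows "encode i F $ (b * \<beta> + t) = (\<Sum>a<d. \<psi> i a * message F t a b)"
  using assms index_less[OF assms] by (simp add: encode_def)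

lemma message_add:
  assumes "F \<in> carrier_vec B" "G \<in> carrier_vec B" "a < d" "b < d" "t < \<beta>"
  shows "message (F + G) t a b = message F t a b + message G t a b"
  using assms h_less[of a b t] by (simp add: message_def del: min_less_iff_disj)

lemma message_smult:
  assumes "F \<in> carrier_vec B" "a < d" "b < d" "t < \<beta>"
  shows "message (r \<cdot>\<^sub>v F) t a b = r * message F t a b"
  using assms h_less[of a b t] by (simp add: message_def del: min_less_iff_disj)

lemma linear_code_encode: "linear_code n B (d * \<beta>) encode"
proof -
  have "encode i (F + G) = encode i F + encode i G"
    if "F \<in> carrier_vec B" "G \<in> carrier_vec B" for i F G
    using that
    by (intro eq_vecI) (simp_all add: encode_def index_bounds message_add distrib_left sum.distrib)
  moreover have "encode i (r \<cdot>\<^sub>v F) = r \<cdot>\<^sub>v encode i F" if "F \<in> carrier_vec B" for i r F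
    using that
    by (intro eq_vecI)
      (simp_all add: encode_def index_bounds message_smult sum_distrib_left mult.left_commute)
  moreover have "encode i F \<in> carrier_vec (d * \<beta>)" for i F
    by (simp add: encode_def)
  ultimately show ?thesis
    by (auto simp: linear_code_def linear_map_def mod_hom_def mod_hom_axioms_def
        LinearCombinations.module_hom_def module_vec_simps class_ring_simps vec_vs vec_module)
qed

lemma systematic_nodes_encode:
  assumes "k \<le> n"
  shows "systematic_nodes n k B (d * \<beta>) encode {..<k}"
proof -
  have "\<exists>b<B. \<forall>F\<in>carrier_vec B. encode i F $ s = F $ b" if i: "i < k" and s: "s < d * \<beta>" for i s
  proof (intro exI conjI ballI)
    show "h (min i (s div \<beta>), max i (s div \<beta>), s mod \<beta>) < B"
      using i s k_le_d index_bounds by (intro h_less) auto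
    show "encode i F $ s = F $ h (min i (s div \<beta>), max i (s div \<beta>), s mod \<beta>)" for F
    proof -
      have "encode i F $ s = (\<Sum>a<d. if a = i then message F (s mod \<beta>) a (s div \<beta>) else 0)"
        unfolding encode_def index_vec[OF s] by (intro sum.cong) (auto simp: systematic[OF i])
      \<comment> \<open>Since \<open>i < k\<close>, row \<open>i\<close> avoids the zero block, so
        the entry is a file symbol.\<close>
      then show ?thesis
        using i k_le_d by (simp add: message_def)
    qed
  qed
  then show ?thesis
    using assms by (simp add: systematic_nodes_def)
qed

text \<open>By linearity it suffices that the difference \<open>N\<close> of the two message
  matrices vanishes; this is shown first for the columns from \<open>k\<close> on, then, through
  symmetry, for the others.\<close>

lemma file_recoverable_encode:
  assumes K: "K \<subseteq> {..<n}" "card K = k"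
  shows "file_recoverable B encode K"
  unfolding file_recoverable_def
proof (rule recoverable_fromI)
  fix F F' :: "'a vec"
  assume F: "F \<in> carrier_vec B" "F' \<in> carrier_vec B"
    and eq: "(\<lambda>j\<in>K. encode j F) = (\<lambda>j\<in>K. encode j F')"
  define N where "N t a b = message F t a b - message F' t a b" for t a b
  have sym: "N t a b = N t b a" for t a b
    by (simp add: N_def message_sym)
  have N0: "N t a b = 0" if "k \<le> a" "k \<le> b" for t a b
    using that by (simp add: N_def message_def)
  have node: "(\<Sum>a<d. \<psi> j a * N t a b) = 0" if "j \<in> K" "b < d" "t < \<beta>" for j t b
  proof -
    have "encode j F = encode j F'"
      using fun_cong[OF eq, of j] that by simp
    then show ?thesis
      using encode_index[of b t j F] encode_index[of b t j F'] that
      by (simp add: N_def right_diff_distrib sum_subtractf)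
  qed
  \<comment> \<open>A column supported in the first \<open>k\<close> rows meets only the first
    \<open>k\<close> entries of each \<open>\<psi> j\<close>, so independence at
    \<open>m = k\<close> applies.\<close>
  have vanish: "N t a b = 0" if t: "t < \<beta>" and b: "b < d" and a: "a < k"
    and "\<forall>a. k \<le> a \<longrightarrow> a < d \<longrightarrow> N t a b = 0" for t a b
  proof (rule rows_independent[of k K "\<lambda>a. N t a b", OF _ K _ a])
    show "\<forall>j\<in>K. (\<Sum>a<k. \<psi> j a * N t a b) = 0"
    proof
      fix j assume "j \<in> K"
      have "(\<Sum>a<d. \<psi> j a * N t a b) = (\<Sum>a<k. \<psi> j a * N t a b)"
        using that k_le_d by (intro sum.mono_neutral_right) auto
      then show "(\<Sum>a<k. \<psi> j a * N t a b) = 0"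
        using node[OF \<open>j \<in> K\<close> b t] by simp
    qed
  qed simp
  \<comment> \<open>Below row \<open>k\<close> these columns lie in the zero block.\<close>
  have right: "N t a b = 0" if "t < \<beta>" "a < k" "k \<le> b" "b < d" for t a b
    using that by (intro vanish) (auto intro: N0)
  \<comment> \<open>For \<open>b < k\<close>, the entries below row \<open>k\<close> mirror those
    covered by \<open>right\<close>.\<close>
  have all: "N t a b = 0" if "t < \<beta>" "a < k" "b < d" for t a b
    using that right sym N0 by (intro vanish) (metis not_le)+
  show "F = F'"
  proof (rule eq_vecI)
    fix s assume "s < dim_vec F'"
    then have "s \<in> {..<B}"
      using F by simp
    then obtain a b t where abt: "a < k" "a \<le> b" "b < d" "t < \<beta>" and s: "s = h (a, b, t)"
      using bij_betw_imp_surj_on[OF h] by blast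
    then show "F $ s = F' $ s"
      using all[of t a b] by (simp add: N_def message_def min_def max_def)
  qed (use F in simp)
qed

lemma repairs_encode:
  assumes D: "D \<subseteq> {..<n}" "card D = d"
  shows "repairs B encode i D (\<lambda>j. helper i)"
  unfolding repairs_def
proof (rule recoverable_fromI)
  fix F F' :: "'a vec"
  assume eq: "(\<lambda>j\<in>D. helper i (encode j F)) = (\<lambda>j\<in>D. helper i (encode j F'))"
  \<comment> \<open>The product of the \<open>t\<close>-th message matrix with the row of the failed
    node; \<open>d\<close> independent helper rows determine it.\<close>
  define v where "v G t a = (\<Sum>b<d. message G t a b * \<psi> i b)" for G t a
  have helper: "helper i (encode j G) $ t = (\<Sum>a<d. \<psi> j a * v G t a)" if "t < \<beta>" for j t G
  proof -
    have "helper i (encode j G) $ t = (\<Sum>b<d. \<Sum>a<d. \<psi> j a * message G t a b * \<psi> i b)"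
      using that by (simp add: helper_def encode_index sum_distrib_right)
    also have "\<dots> = (\<Sum>a<d. \<Sum>b<d. \<psi> j a * message G t a b * \<psi> i b)"
      by (rule sum.swap)
    finally show ?thesis
      by (simp add: v_def sum_distrib_left mult.assoc)
  qed
  have v: "v F t b = v F' t b" if t: "t < \<beta>" and b: "b < d" for t b
  proof -
    have "\<forall>j\<in>D. (\<Sum>a<d. \<psi> j a * (v F t a - v F' t a)) = 0"
    proof
      fix j assume "j \<in> D"
      then have "helper i (encode j F) = helper i (encode j F')"
        using fun_cong[OF eq, of j] by simp
      then show "(\<Sum>a<d. \<psi> j a * (v F t a - v F' t a)) = 0"
        using helper[OF t, of j F] helper[OF t, of j F']
        by (simp add: right_diff_distrib sum_subtractf)
    qed
    then have "v F t b - v F' t b = 0"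
      by (intro rows_independent[OF _ D, of "\<lambda>a. v F t a - v F' t a"]) (use b in auto)
    then show ?thesis
      by simp
  qed
  \<comment> \<open>Symmetry of the message matrix turns this product into the stored data.\<close>
  have "encode i G $ s = v G (s mod \<beta>) (s div \<beta>)" if "s < d * \<beta>" for G s
    using that by (simp add: encode_def v_def message_sym[of G _ _ "s div \<beta>"] mult.commute)
  then show "encode i F = encode i F'"
    using v index_bounds by (intro eq_vecI) (auto simp: encode_def)
qed

lemma has_download_helper: "has_download \<alpha> (helper i) \<beta>"
  by (simp add: has_download_def helper_def)

text \<open>The inner product with a unit vector selects entry \<open>i\<close> of each copy, that
  is, the block of \<open>\<beta>\<close> positions starting at \<open>i * \<beta>\<close>.\<close>

lemma by_transfer_helper:
  assumes i: "i < k"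
  shows "by_transfer (d * \<beta>) (helper i) \<beta>"
  unfolding by_transfer_def
proof (intro exI conjI ballI)
  show "(\<lambda>t. i * \<beta> + t) \<in> {..<\<beta>} \<rightarrow> {..<d * \<beta>}"
    using i k_le_d index_less by auto
  show "inj_on (\<lambda>t. i * \<beta> + t) {..<\<beta>}"
    by (simp add: inj_on_def)
  show "helper i w = vec \<beta> (\<lambda>t. w $ (i * \<beta> + t))" for w
  proof (rule eq_vecI)
    fix t assume "t < dim_vec (vec \<beta> (\<lambda>t. w $ (i * \<beta> + t)))"
    then have "helper i w $ t = (\<Sum>b<d. if b = i then w $ (b * \<beta> + t) else 0)"
      by (simp add: helper_def systematic[OF i] if_distrib cong: if_cong)
    then show "helper i w $ t = vec \<beta> (\<lambda>t. w $ (i * \<beta> + t)) $ t"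
      using i k_le_d \<open>t < _\<close> by simp
  qed (simp add: helper_def)
qed

end

section \<open>Choice of parameters and assembly\<close>

theorem mainTheorem2:
  fixes n k d \<beta> \<alpha> B :: nat
  assumes "0 < n" and "0 < k" and "0 < d" and "0 < \<beta>"
    and "k \<le> d" and "d < n"
    and "n \<le> card (UNIV :: 'a::{finite,field} set)"
    and "\<alpha> = d * \<beta>"
    and "B = (k * d - (k choose 2)) * \<beta>"
  shows "real \<beta> = real B / (real (k * d) - real (k choose 2)) \<and>
    (\<exists>(f :: nat \<Rightarrow> 'a vec \<Rightarrow> 'a vec) S.
       linear_code n B \<alpha> f \<and>
       systematic_nodes n k B \<alpha> f S \<and>
       (\<forall>K\<subseteq>{..<n}. card K = k \<longrightarrow> file_recoverable B f K) \<and>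
       (\<forall>i<n. \<forall>D\<subseteq>{..<n} - {i}. card D = d \<longrightarrow>
          (\<exists>\<phi>. repairs B f i D \<phi> \<and> (\<forall>j\<in>D. has_download \<alpha> (\<phi> j) \<beta>))) \<and>
       (\<forall>i\<in>S. \<forall>D\<subseteq>{..<n} - {i}. card D = d \<longrightarrow>
          (\<exists>\<phi>. repairs B f i D \<phi> \<and>
               (\<forall>j\<in>D. has_download \<alpha> (\<phi> j) \<beta> \<and> read_count \<alpha> (\<phi> j) = \<beta> \<and>
                       by_transfer \<alpha> (\<phi> j) \<beta>))))"
proof (rule conjI)
  let ?U = "{(a, b). a < k \<and> a \<le> b \<and> b < d}"
  have finU: "finite ?U"
    by (rule finite_subset[of _ "{..<k} \<times> {..<d}"]) auto
  have cardU: "card ?U + (k choose 2) = k * d"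
    using card_upper_triangle \<open>k \<le> d\<close> .
  \<comment> \<open>This makes the denominator of the claimed quotient nonzero.\<close>
  have "(0, 0) \<in> ?U"
    using assms by simp
  then have "0 < card ?U"
    using finU card_gt_0_iff by blast
  moreover have "real (k * d) - real (k choose 2) = real (card ?U)"
    unfolding cardU[symmetric] by simp
  moreover have B: "B = card ?U * \<beta>"
    using assms(9) unfolding cardU[symmetric] by simp
  ultimately show "real \<beta> = real B / (real (k * d) - real (k choose 2))"
    by simp

  \<comment> \<open>The field size bound supplies the \<open>n\<close> distinct evaluation
    points.\<close>
  obtain x :: "nat \<Rightarrow> 'a" where x: "inj_on x {..<n}"
    using card_le_inj[of "{..<n}" "UNIV :: 'a set"] assms(7) by auto
  have "k \<le> n"
    using assms by simp
  obtain \<psi> :: "nat \<Rightarrow> nat \<Rightarrow> 'a"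
    where \<psi>: "\<And>i a. i < k \<Longrightarrow> \<psi> i a = (if a = i then 1 else 0)"
      "\<And>m J c a. k \<le> m \<Longrightarrow> J \<subseteq> {..<n} \<Longrightarrow> card J = m \<Longrightarrow>
         \<forall>j\<in>J. (\<Sum>a<m. \<psi> j a * c a) = 0 \<Longrightarrow> a < m \<Longrightarrow> c a = 0"
  proof (rule exists_systematic_MDS_rows[OF x \<open>k \<le> n\<close>])
    fix \<psi> :: "nat \<Rightarrow> nat \<Rightarrow> 'a"
    assume "\<And>i a. i < k \<Longrightarrow> \<psi> i a = (if a = i then 1 else 0)"
      and "\<And>m J c a. k \<le> m \<Longrightarrow> J \<subseteq> {..<n} \<Longrightarrow> card J = m \<Longrightarrow>
         \<forall>j\<in>J. (\<Sum>a<m. \<psi> j a * c a) = 0 \<Longrightarrow> a < m \<Longrightarrow> c a = 0"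
    then show thesis
      by (rule that)
  qed
  let ?V = "{(a, b, t). a < k \<and> a \<le> b \<and> b < d \<and> t < \<beta>}"
  \<comment> \<open>Regrouping shows that the \<open>\<beta>\<close> copies together have exactly
    \<open>B\<close> free entries, which \<open>h\<close> then numbers.\<close>
  have bij: "bij_betw (\<lambda>((a, b), t). (a, b, t)) (?U \<times> {..<\<beta>}) ?V"
    by (rule bij_betwI[where g = "\<lambda>(a, b, t). ((a, b), t)"]) auto
  have "finite ?V"
    using bij_betw_finite[OF bij] finU by simp
  moreover have "card ?V = B"
    using bij_betw_same_card[OF bij] B by (simp add: card_cartesian_product)
  ultimately obtain h where h: "bij_betw h ?V {..<B}"
    using ex_bij_betw_finite_nat[of ?V] unfolding atLeast0LessThan by auto
  interpret product_matrix_code n k d \<beta> B \<psi> h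
  proof
    show "c a = 0" if "m = k \<or> m = d" "J \<subseteq> {..<n}" "card J = m"
      "\<forall>j\<in>J. (\<Sum>a<m. \<psi> j a * c a) = 0" "a < m" for m J a and c :: "nat \<Rightarrow> 'a"
      using \<psi>(2)[OF _ that(2-5)] that(1) \<open>k \<le> d\<close> by auto
  qed (fact \<open>k \<le> d\<close> h \<psi>(1))+
  show "\<exists>(f :: nat \<Rightarrow> 'a vec \<Rightarrow> 'a vec) S.
       linear_code n B \<alpha> f \<and>
       systematic_nodes n k B \<alpha> f S \<and>
       (\<forall>K\<subseteq>{..<n}. card K = k \<longrightarrow> file_recoverable B f K) \<and>
       (\<forall>i<n. \<forall>D\<subseteq>{..<n} - {i}. card D = d \<longrightarrow>
          (\<exists>\<phi>. repairs B f i D \<phi> \<and> (\<forall>j\<in>D. has_download \<alpha> (\<phi> j) \<beta>))) \<and>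
       (\<forall>i\<in>S. \<forall>D\<subseteq>{..<n} - {i}. card D = d \<longrightarrow>
          (\<exists>\<phi>. repairs B f i D \<phi> \<and>
               (\<forall>j\<in>D. has_download \<alpha> (\<phi> j) \<beta> \<and> read_count \<alpha> (\<phi> j) = \<beta> \<and>
                       by_transfer \<alpha> (\<phi> j) \<beta>)))"
    unfolding \<open>\<alpha> = d * \<beta>\<close>
  proof (rule exI[of _ encode], rule exI[of _ "{..<k}"], intro conjI ballI allI impI)
    show "linear_code n B (d * \<beta>) encode"
      by (rule linear_code_encode)
    show "systematic_nodes n k B (d * \<beta>) encode {..<k}"
      using \<open>k \<le> n\<close> by (rule systematic_nodes_encode)
    show "file_recoverable B encode K" if "K \<subseteq> {..<n}" "card K = k" for K
      using that by (rule file_recoverable_encode)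
  next
    fix i D assume "D \<subseteq> {..<n} - {i}" "card D = d"
    then show "\<exists>\<phi>. repairs B encode i D \<phi> \<and> (\<forall>j\<in>D. has_download (d * \<beta>) (\<phi> j) \<beta>)"
      using repairs_encode[of D i] has_download_helper by blast
  next
    fix i D assume "i \<in> {..<k}" "D \<subseteq> {..<n} - {i}" "card D = d"
    then show "\<exists>\<phi>. repairs B encode i D \<phi> \<and>
        (\<forall>j\<in>D. has_download (d * \<beta>) (\<phi> j) \<beta> \<and> read_count (d * \<beta>) (\<phi> j) = \<beta> \<and>
           by_transfer (d * \<beta>) (\<phi> j) \<beta>)"
      using repairs_encode[of D i] has_download_helper by_transfer_helper[of i]
        read_count_transfer by blast
  qed
qed

end
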